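(* Let $(F,\mu,\eta)$ be a weak monad and $(G,\delta,\varepsilon)$ a weak comonad on a category $\mathbb{A}$, and let $\omega:FG\to GF$ be a natural transformation. Put $\vartheta=\mu\cdot F\eta$, $\gamma=G\varepsilon\cdot\delta$, $$\xi=\varepsilon F\cdot\omega\cdot\eta G:G\to F,\qquad \widehat\kappa=G\mu\cdot\omega F\cdot\eta GF:GF\to GF .$$ Assume $$\omega\cdot\mu G=G\mu\cdot\omega F\cdot F\omega,\qquad \omega\cdot\vartheta G=\omega=G\vartheta\cdot\omega,$$ $$\delta F\cdot\omega=G\omega\cdot\omega G\cdot F\delta,\qquad \omega\cdot F\gamma=\omega=\gamma F\cdot\omega,$$ $$\varepsilon F\cdot\omega=\mu\cdot F\varepsilon F\cdot F\omega\cdot F\eta G .$$ Let $\overline G:\underline{\mathbb{A}}_F\to\underline{\mathbb{A}}_F$, $(A,\varphi)\mapsto(G(A),G\varphi\cdot\omega_A)$, be the lifting of $G$ to compatible $F$-modules, and for $(A,\varphi)\in\underline{\mathbb{A}}_F$ let $\overline\varepsilon_A=\varphi\cdot\xi_A:G(A)\to A$. (1) If $\omega\cdot\eta G=G\varepsilon F\cdot G\omega\cdot G\eta G\cdot\delta$, then $\overline\varepsilon$ is regular for $\delta$ (that is, $\overline\varepsilon\cdot\overline G\,\overline\varepsilon\cdot\delta=\overline\varepsilon$), and for the natural transformation $\overline\delta:\overline G\to\overline G\,\overline G$ with components $\overline\delta_{A}=G(G\varphi\cdot\omega_A\cdot\eta_{G(A)})\cdot\delta_A$ at $(A,\varphi)\in\underline{\mathbb{A}}_F$,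 so that on free modules $$\overline\delta F=G\widehat\kappa\cdot\delta F: GF\to GGF,$$ $(\overline G,\overline\delta,\overline\varepsilon)$ is an $r$-counital comonad on $\underline{\mathbb{A}}_F$. (2) If $\omega\cdot\eta G=G\eta\cdot\gamma$, then $\overline\delta F=\delta F\cdot\widehat\kappa$ and $(\overline G,\overline\delta,\overline\varepsilon)$ is a weak comonad on $\underline{\mathbb{A}}_F$.
   Context: A $q$-unital monad $(F,\mu,\eta)$ on $\mathbb{A}$: endofunctor $F$, natural $\mu:FF\to F$ with $\mu\cdot F\mu=\mu\cdot\mu F$, and any natural $\eta:I_{\mathbb{A}}\to F$. It is a weak monad if $\mu\cdot F\eta\cdot\eta=\eta$ ($\eta$ regular), $\mu\cdot F\eta=\mu\cdot\eta F$ ($\eta$ symmetric), and $\mu=\mu\cdot\mu F\cdot F\eta F$ ($\mu$ compatible). A $q$-counital comonad $(G,\delta,\varepsilon)$ on $\mathbb{A}$: endofunctor $G$, natural $\delta:G\to GG$ with $G\delta\cdot\delta=\delta G\cdot\delta$, and any natural $\varepsilon:G\to I_{\mathbb{A}}$. It is $r$-counital if $\varepsilon\cdot G\varepsilon\cdot\delta=\varepsilon$ ($\varepsilon$ regular) and $\delta=G\varepsilon G\cdot\delta G\cdot\delta$ ($\delta$ compatible); it is a weak comonad if moreover $G\varepsilon\cdot\delta=\varepsilon G\cdot\delta$ ($\varepsilon$ symmetric). $\underline{\mathbb{A}}_F$ is the category of compatible $F$-modules: pairs $(A,\varphi:F(A)\to A)$ with $\varphi\cdot F\varphi=\varphi\cdot\mu_A$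 and $\varphi=\varphi\cdot\mu_A\cdot F\eta_A$; morphisms are $f:A\to A'$ with $\varphi'\cdot F(f)=f\cdot\varphi$. The free module on $A$ is $(F(A),\mu_A)$. *)

theory Defs
  imports Main
begin

section \<open>Categories, functors, natural transformations\<close>

text \<open>Arrows carry their domain and codomain; composition is in the usual order
  (\<open>g \<cdot> f\<close> is ``first \<open>f\<close>, then \<open>g\<close>'') and is only constrained on composable pairs of arrows.\<close>

record ('o, 'm) category =
  Obj :: "'o set"
  Arr :: "'m set"
  Dom :: "'m \<Rightarrow> 'o"
  Cod :: "'m \<Rightarrow> 'o"
  Ide :: "'o \<Rightarrow> 'm"
  Comp :: "'m \<Rightarrow> 'm \<Rightarrow> 'm" (infixr "\<cdot>\<index>" 70)

definition hom :: "('o, 'm) category \<Rightarrow> 'o \<Rightarrow> 'o \<Rightarrow> 'm set" where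
  "hom C A B = {f \<in> Arr C. Dom C f = A \<and> Cod C f = B}"

locale category =
  fixes C :: "('o, 'm) category" (structure)
  assumes Dom_in_Obj: "f \<in> Arr C \<Longrightarrow> Dom C f \<in> Obj C"
    and Cod_in_Obj: "f \<in> Arr C \<Longrightarrow> Cod C f \<in> Obj C"
    and Ide_in_hom: "A \<in> Obj C \<Longrightarrow> Ide C A \<in> hom C A A"
    and Comp_in_hom: "f \<in> hom C A B \<Longrightarrow> g \<in> hom C B D \<Longrightarrow> g \<cdot> f \<in> hom C A D"
    and Comp_Ide: "f \<in> hom C A B \<Longrightarrow> f \<cdot> Ide C A = f"
    and Ide_Comp: "f \<in> hom C A B \<Longrightarrow> Ide C B \<cdot> f = f"
    and Comp_assoc: "f \<in> hom C A B \<Longrightarrow> g \<in> hom C B D \<Longrightarrow> h \<in> hom C D E \<Longrightarrow>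
          (h \<cdot> g) \<cdot> f = h \<cdot> (g \<cdot> f)"

record ('o, 'm, 'p, 'n) fctr =
  fo :: "'o \<Rightarrow> 'p"
  fa :: "'m \<Rightarrow> 'n"

locale is_functor = C: category C + D: category D
  for C :: "('o, 'm) category" and D :: "('p, 'n) category" +
  fixes F :: "('o, 'm, 'p, 'n) fctr"
  assumes fo_in_Obj: "A \<in> Obj C \<Longrightarrow> fo F A \<in> Obj D"
    and fa_in_hom: "f \<in> hom C A B \<Longrightarrow> fa F f \<in> hom D (fo F A) (fo F B)"
    and fa_Ide: "A \<in> Obj C \<Longrightarrow> fa F (Ide C A) = Ide D (fo F A)"
    and fa_Comp: "f \<in> hom C A B \<Longrightarrow> g \<in> hom C B E \<Longrightarrow>
          fa F (g \<cdot>\<^bsub>C\<^esub> f) = fa F g \<cdot>\<^bsub>D\<^esub> fa F f"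

definition id_functor :: "('o, 'm, 'o, 'm) fctr" where
  "id_functor = \<lparr>fo = (\<lambda>A. A), fa = (\<lambda>f. f)\<rparr>"

definition comp_functor ::
  "('p, 'n, 'q, 'k) fctr \<Rightarrow> ('o, 'm, 'p, 'n) fctr \<Rightarrow> ('o, 'm, 'q, 'k) fctr"
  (infixr "\<circ>\<^sub>F" 75) where
  "G \<circ>\<^sub>F F = \<lparr>fo = (\<lambda>A. fo G (fo F A)), fa = (\<lambda>f. fa G (fa F f))\<rparr>"

text \<open>A natural transformation is the family of its components. Consequently the whiskered
  transformations \<open>(F \<alpha>)\<close> and \<open>(\<alpha> F)\<close> have components \<open>fa F (\<alpha> A)\<close> and \<open>\<alpha> (fo F A)\<close> at \<open>A\<close>, and
  equality of natural transformations is equality of components at all objects.\<close>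

locale natural_transformation = S: is_functor C D S + T: is_functor C D T
  for C :: "('o, 'm) category" and D :: "('p, 'n) category"
    and S :: "('o, 'm, 'p, 'n) fctr" and T :: "('o, 'm, 'p, 'n) fctr" +
  fixes \<alpha> :: "'o \<Rightarrow> 'n"
  assumes component_in_hom: "A \<in> Obj C \<Longrightarrow> \<alpha> A \<in> hom D (fo S A) (fo T A)"
    and naturality: "f \<in> hom C A B \<Longrightarrow> \<alpha> B \<cdot>\<^bsub>D\<^esub> fa S f = fa T f \<cdot>\<^bsub>D\<^esub> \<alpha> A"

type_synonym ('o, 'm) endo = "('o, 'm, 'o, 'm) fctr"


section \<open>Weak monads and weak comonads\<close>

locale q_unital_monad = category C
  for C :: "('o, 'm) category" (structure) +
  fixes F :: "('o, 'm) endo" and \<mu> \<eta> :: "'o \<Rightarrow> 'm"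
  assumes functor_F: "is_functor C C F"
    and natural_mu: "natural_transformation C C (F \<circ>\<^sub>F F) F \<mu>"
    and natural_eta: "natural_transformation C C id_functor F \<eta>"
    and mu_assoc: "A \<in> Obj C \<Longrightarrow> \<mu> A \<cdot> fa F (\<mu> A) = \<mu> A \<cdot> \<mu> (fo F A)"

locale weak_monad = q_unital_monad +
  assumes eta_regular: "A \<in> Obj C \<Longrightarrow> \<mu> A \<cdot> fa F (\<eta> A) \<cdot> \<eta> A = \<eta> A"
    and eta_symmetric: "A \<in> Obj C \<Longrightarrow> \<mu> A \<cdot> fa F (\<eta> A) = \<mu> A \<cdot> \<eta> (fo F A)"
    and mu_compatible: "A \<in> Obj C \<Longrightarrow> \<mu> A = \<mu> A \<cdot> \<mu> (fo F A) \<cdot> fa F (\<eta> (fo F A))"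

locale q_counital_comonad = category C
  for C :: "('o, 'm) category" (structure) +
  fixes G :: "('o, 'm) endo" and \<delta> \<epsilon> :: "'o \<Rightarrow> 'm"
  assumes functor_G: "is_functor C C G"
    and natural_delta: "natural_transformation C C G (G \<circ>\<^sub>F G) \<delta>"
    and natural_eps: "natural_transformation C C G id_functor \<epsilon>"
    and delta_coassoc: "A \<in> Obj C \<Longrightarrow> fa G (\<delta> A) \<cdot> \<delta> A = \<delta> (fo G A) \<cdot> \<delta> A"

definition regular_counit ::
  "('o, 'm) category \<Rightarrow> ('o, 'm) endo \<Rightarrow> ('o \<Rightarrow> 'm) \<Rightarrow> ('o \<Rightarrow> 'm) \<Rightarrow> bool" where
  "regular_counit C G \<delta> \<epsilon> \<longleftrightarrow> (\<forall>A \<in> Obj C. \<epsilon> A \<cdot>\<^bsub>C\<^esub> fa G (\<epsilon> A) \<cdot>\<^bsub>C\<^esub> \<delta> A = \<epsilon> A)"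

locale r_counital_comonad = q_counital_comonad +
  assumes eps_regular: "regular_counit C G \<delta> \<epsilon>"
    and delta_compatible: "A \<in> Obj C \<Longrightarrow>
          \<delta> A = fa G (\<epsilon> (fo G A)) \<cdot> \<delta> (fo G A) \<cdot> \<delta> A"

locale weak_comonad = r_counital_comonad +
  assumes eps_symmetric: "A \<in> Obj C \<Longrightarrow> fa G (\<epsilon> A) \<cdot> \<delta> A = \<epsilon> (fo G A) \<cdot> \<delta> A"


section \<open>Compatible modules\<close>

text \<open>One arrow \<open>f\<close> of the base category may underlie morphisms between several pairs of modules.
  A module morphism is therefore a triple (source module, underlying arrow, target module).\<close>

type_synonym ('o, 'm) fmod = "'o \<times> 'm"
type_synonym ('o, 'm) fmod_arr = "('o, 'm) fmod \<times> 'm \<times> ('o, 'm) fmod"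

definition underlying :: "('o, 'm) fmod_arr \<Rightarrow> 'm" where
  "underlying t = fst (snd t)"

definition compatible_module ::
  "('o, 'm) category \<Rightarrow> ('o, 'm) endo \<Rightarrow> ('o \<Rightarrow> 'm) \<Rightarrow> ('o \<Rightarrow> 'm) \<Rightarrow> ('o, 'm) fmod \<Rightarrow> bool" where
  "compatible_module C F \<mu> \<eta> = (\<lambda>(A, \<phi>).
     A \<in> Obj C \<and> \<phi> \<in> hom C (fo F A) A \<and>
     \<phi> \<cdot>\<^bsub>C\<^esub> fa F \<phi> = \<phi> \<cdot>\<^bsub>C\<^esub> \<mu> A \<and>
     \<phi> = \<phi> \<cdot>\<^bsub>C\<^esub> \<mu> A \<cdot>\<^bsub>C\<^esub> fa F (\<eta> A))"

definition module_category ::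
  "('o, 'm) category \<Rightarrow> ('o, 'm) endo \<Rightarrow> ('o \<Rightarrow> 'm) \<Rightarrow> ('o \<Rightarrow> 'm) \<Rightarrow>
   (('o, 'm) fmod, ('o, 'm) fmod_arr) category" where
  "module_category C F \<mu> \<eta> =
    \<lparr>Obj = {M. compatible_module C F \<mu> \<eta> M},
     Arr = {(M, f, N). compatible_module C F \<mu> \<eta> M \<and> compatible_module C F \<mu> \<eta> N \<and>
              f \<in> hom C (fst M) (fst N) \<and> snd N \<cdot>\<^bsub>C\<^esub> fa F f = f \<cdot>\<^bsub>C\<^esub> snd M},
     Dom = (\<lambda>(M, f, N). M),
     Cod = (\<lambda>(M, f, N). N),
     Ide = (\<lambda>M. (M, Ide C (fst M), M)),
     Comp = (\<lambda>(N', g, K) (M, f, N). (M, g \<cdot>\<^bsub>C\<^esub> f, K))\<rparr>"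

definition free_module :: "('o, 'm) endo \<Rightarrow> ('o \<Rightarrow> 'm) \<Rightarrow> 'o \<Rightarrow> ('o, 'm) fmod" where
  "free_module F \<mu> A = (fo F A, \<mu> A)"

lemma (in weak_monad) free_module_compatible:
  assumes "A \<in> Obj C"
  shows "free_module F \<mu> A \<in> Obj (module_category C F \<mu> \<eta>)"
proof -
  have "fo F A \<in> Obj C"
    using functor_F assms by (rule is_functor.fo_in_Obj)
  moreover have "\<mu> A \<in> hom C (fo F (fo F A)) (fo F A)"
    using natural_transformation.component_in_hom[OF natural_mu assms]
    by (simp add: comp_functor_def)
  ultimately show ?thesis
    using mu_assoc[OF assms] mu_compatible[OF assms]
    by (simp add: module_category_def compatible_module_def free_module_def)
qed


section \<open>Transformations built from a natural transformation \<open>\<omega> : FG \<rightarrow> GF\<close>\<close>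

context
  fixes C :: "('o, 'm) category" (structure)
    and F :: "('o, 'm) endo" and \<mu> \<eta> :: "'o \<Rightarrow> 'm"
    and G :: "('o, 'm) endo" and \<delta> \<epsilon> :: "'o \<Rightarrow> 'm"
    and \<omega> :: "'o \<Rightarrow> 'm"
begin

definition theta :: "'o \<Rightarrow> 'm" where
  "theta A = \<mu> A \<cdot> fa F (\<eta> A)"

definition gamma :: "'o \<Rightarrow> 'm" where
  "gamma A = fa G (\<epsilon> A) \<cdot> \<delta> A"

definition xi :: "'o \<Rightarrow> 'm" where
  "xi A = \<epsilon> (fo F A) \<cdot> \<omega> A \<cdot> \<eta> (fo G A)"

definition kappa_hat :: "'o \<Rightarrow> 'm" where
  "kappa_hat A = fa G (\<mu> A) \<cdot> \<omega> (fo F A) \<cdot> \<eta> (fo G (fo F A))"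

definition lift_obj :: "('o, 'm) fmod \<Rightarrow> ('o, 'm) fmod" where
  "lift_obj = (\<lambda>(A, \<phi>). (fo G A, fa G \<phi> \<cdot> \<omega> A))"

definition lift_functor :: "(('o, 'm) fmod, ('o, 'm) fmod_arr) endo" where
  "lift_functor = \<lparr>fo = lift_obj, fa = (\<lambda>(M, f, N). (lift_obj M, fa G f, lift_obj N))\<rparr>"

definition eps_bar :: "('o, 'm) fmod \<Rightarrow> ('o, 'm) fmod_arr" where
  "eps_bar = (\<lambda>(A, \<phi>). (lift_obj (A, \<phi>), \<phi> \<cdot> xi A, (A, \<phi>)))"

text \<open>\<open>\<delta>\<close> itself, read as a transformation from the lifting of \<open>G\<close> to its square.\<close>

definition delta_mod :: "('o, 'm) fmod \<Rightarrow> ('o, 'm) fmod_arr" where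
  "delta_mod = (\<lambda>(A, \<phi>). (lift_obj (A, \<phi>), \<delta> A, lift_obj (lift_obj (A, \<phi>))))"

definition delta_bar :: "('o, 'm) fmod \<Rightarrow> ('o, 'm) fmod_arr" where
  "delta_bar = (\<lambda>(A, \<phi>). (lift_obj (A, \<phi>),
      fa G (fa G \<phi> \<cdot> \<omega> A \<cdot> \<eta> (fo G A)) \<cdot> \<delta> A,
      lift_obj (lift_obj (A, \<phi>))))"

end

end

theory Submission
  imports Defs
begin

text \<open>
  Every compatible module \<open>(A, \<phi>)\<close> carries the endomorphism \<open>e = \<phi> \<cdot> \<eta>\<^sub>A\<close>. It is a module
  morphism, since \<open>e \<cdot> \<phi> = \<phi> = \<phi> \<cdot> F e\<close>, and it commutes with all module morphisms; so \<open>e\<close> is a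
  natural transformation from the identity functor of the module category to itself. In terms of
  \<open>e\<close> the data of the theorem read, at a module \<open>M = (A, \<phi>)\<close> with lifting \<open>GM\<close>,
  \<open>\<epsilon>bar\<^sub>M = \<epsilon>\<^sub>A \<cdot> e\<^bsub>GM\<^esub>\<close> and \<open>\<delta>bar\<^sub>M = G e\<^bsub>GM\<^esub> \<cdot> \<delta>\<^sub>A\<close>.

  The hypotheses on \<open>\<omega>\<close> imply that \<open>G\<close> lifts to modules and that \<open>\<delta>\<close> and \<open>\<epsilon>bar\<close> are natural
  transformations of module functors, so \<open>\<delta>\<close> and \<open>\<epsilon>bar\<close> form a q-counital comonad on modules,
  and \<open>\<epsilon>bar\<^sub>M \<cdot> e\<^bsub>GM\<^esub> = \<epsilon>bar\<^sub>M\<close>. Composing the hypothesis of the first part with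
  \<open>G\<phi>\<close> gives \<open>e\<^bsub>GM\<^esub> = G \<epsilon>bar\<^sub>M \<cdot> \<delta>\<^sub>A\<close>. From here on the argument is purely formal and takes place in an
  arbitrary category (\<open>r_counital_comonad_twist\<close>): if a q-counital comonad satisfies
  \<open>G\<epsilon> \<cdot> \<delta> = eG\<close> and \<open>\<epsilon> \<cdot> eG = \<epsilon>\<close> for some endomorphism \<open>e\<close> of the identity functor, then
  \<open>G(eG) \<cdot> \<delta> = \<delta> \<cdot> eG\<close>, and with this comultiplication the comonad is r-counital; it is weak if
  also \<open>\<epsilon>G \<cdot> \<delta> = eG\<close> (\<open>weak_comonad_twist\<close>).

  For the second part, put \<open>\<gamma> = G\<epsilon> \<cdot> \<delta>\<close>, which is idempotent by regularity of \<open>\<epsilon>\<close>. The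
  hypothesis \<open>\<omega> \<cdot> \<eta>G = G\<eta> \<cdot> \<gamma>\<close> implies that of the first part. Moreover
  \<open>e\<^bsub>GM\<^esub> = G e\<^sub>M \<cdot> \<gamma>\<^sub>A\<close>, so \<open>\<gamma>\<^sub>A \<cdot> e\<^bsub>GM\<^esub> = e\<^bsub>GM\<^esub>\<close>, and symmetry of \<open>\<epsilon>\<close> yields
  \<open>\<epsilon>bar\<^bsub>GM\<^esub> \<cdot> \<delta>\<^sub>A = \<epsilon>\<^bsub>GA\<^esub> \<cdot> e\<^bsub>GGM\<^esub> \<cdot> \<delta>\<^sub>A = \<epsilon>\<^bsub>GA\<^esub> \<cdot> \<delta>\<^sub>A \<cdot> e\<^bsub>GM\<^esub> = \<gamma>\<^sub>A \<cdot> e\<^bsub>GM\<^esub> = e\<^bsub>GM\<^esub>\<close>.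
\<close>

section \<open>Rewriting rules for composable arrows\<close>

text \<open>Phrased through \<open>Arr\<close>, \<open>Dom\<close> and \<open>Cod\<close>, the axioms become conditional rewrite rules whose
  premises the simplifier discharges by itself. The normal form of a composite is associated to
  the right, with functors distributed over composition.\<close>

lemma hom_iff: "f \<in> hom C A B \<longleftrightarrow> f \<in> Arr C \<and> Dom C f = A \<and> Cod C f = B"
  by (simp add: hom_def)

context category
begin

declare Dom_in_Obj [simp] Cod_in_Obj [simp]

lemma Ide_simps [simp]:
  assumes "A \<in> Obj C"
  shows "Ide C A \<in> Arr C" "Dom C (Ide C A) = A" "Cod C (Ide C A) = A"
  using Ide_in_hom[OF assms] by (simp_all add: hom_iff)

lemma Comp_simps [simp]:
  assumes "f \<in> Arr C" "g \<in> Arr C" "Dom C g = Cod C f"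
  shows "g \<cdot> f \<in> Arr C" "Dom C (g \<cdot> f) = Dom C f" "Cod C (g \<cdot> f) = Cod C g"
  using Comp_in_hom[of f _ _ g] assms by (simp_all add: hom_iff)

lemma Comp_assoc_right [simp]:
  assumes "f \<in> Arr C" "g \<in> Arr C" "h \<in> Arr C" "Dom C g = Cod C f" "Dom C h = Cod C g"
  shows "(h \<cdot> g) \<cdot> f = h \<cdot> g \<cdot> f"
  using Comp_assoc[of f _ _ g _ h] assms by (simp add: hom_iff)

lemma Comp_Ide_right [simp]: "f \<in> Arr C \<Longrightarrow> Dom C f = A \<Longrightarrow> f \<cdot> Ide C A = f"
  using Comp_Ide[of f] by (simp add: hom_iff)

lemma Ide_Comp_left [simp]: "f \<in> Arr C \<Longrightarrow> Cod C f = B \<Longrightarrow> Ide C B \<cdot> f = f"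
  using Ide_Comp[of f] by (simp add: hom_iff)

end

context is_functor
begin

declare fo_in_Obj [simp] fa_Ide [simp]

lemma fa_simps [simp]:
  assumes "f \<in> Arr C"
  shows "fa F f \<in> Arr D" "Dom D (fa F f) = fo F (Dom C f)" "Cod D (fa F f) = fo F (Cod C f)"
  using fa_in_hom[of f] assms by (simp_all add: hom_iff)

lemma fa_Comp_simp [simp]:
  assumes "f \<in> Arr C" "g \<in> Arr C" "Dom C g = Cod C f"
  shows "fa F (g \<cdot>\<^bsub>C\<^esub> f) = fa F g \<cdot>\<^bsub>D\<^esub> fa F f"
  using fa_Comp[of f _ _ g] assms by (simp add: hom_iff)

end

context natural_transformation
begin

lemma component_simps [simp]:
  assumes "A \<in> Obj C"
  shows "\<alpha> A \<in> Arr D" "Dom D (\<alpha> A) = fo S A" "Cod D (\<alpha> A) = fo T A"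
  using component_in_hom[OF assms] by (simp_all add: hom_iff)

lemma naturality_Arr:
  assumes "f \<in> Arr C" "Dom C f = A" "Cod C f = B"
  shows "\<alpha> B \<cdot>\<^bsub>D\<^esub> fa S f = fa T f \<cdot>\<^bsub>D\<^esub> \<alpha> A"
  using naturality[of f A B] assms by (simp add: hom_iff)

end

lemma comp_functor_simps [simp]:
  "fo (G \<circ>\<^sub>F F) A = fo G (fo F A)" "fa (G \<circ>\<^sub>F F) f = fa G (fa F f)"
  by (simp_all add: comp_functor_def)

lemma id_functor_simps [simp]: "fo id_functor A = A" "fa id_functor f = f"
  by (simp_all add: id_functor_def)

lemma (in category) is_functor_id: "is_functor C C id_functor"
  by unfold_locales (auto simp: hom_iff)

lemma is_functor_comp:
  assumes "is_functor C D F" "is_functor D E G"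
  shows "is_functor C E (G \<circ>\<^sub>F F)"
proof -
  interpret F: is_functor C D F by fact
  interpret G: is_functor D E G by fact
  show ?thesis by unfold_locales (auto simp: hom_iff)
qed

sublocale q_unital_monad \<subseteq> F: is_functor C C F
  by (rule functor_F)
sublocale q_unital_monad \<subseteq> mu: natural_transformation C C "F \<circ>\<^sub>F F" F \<mu>
  by (rule natural_mu)
sublocale q_unital_monad \<subseteq> eta: natural_transformation C C id_functor F \<eta>
  by (rule natural_eta)

sublocale q_counital_comonad \<subseteq> G: is_functor C C G
  by (rule functor_G)
sublocale q_counital_comonad \<subseteq> delta: natural_transformation C C G "G \<circ>\<^sub>F G" \<delta>
  by (rule natural_delta)
sublocale q_counital_comonad \<subseteq> eps: natural_transformation C C G id_functor \<epsilon>
  by (rule natural_eps)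


section \<open>Twisting a comultiplication by an endomorphism of the identity functor\<close>

context q_counital_comonad
begin

text \<open>Both sides of coassociativity of the twisted comultiplication are \<open>G\<delta> \<cdot> \<delta> = \<delta>G \<cdot> \<delta>\<close> followed by
  components of \<open>e\<close>, which commute with each other and slide past \<open>\<delta>\<close>.\<close>

lemma q_counital_comonad_twist:
  assumes "natural_transformation C C id_functor id_functor e"
    and d: "\<And>A. A \<in> Obj C \<Longrightarrow> d A = fa G (e (fo G A)) \<cdot> \<delta> A"
  shows "q_counital_comonad C G d \<epsilon>"
proof -
  interpret e: natural_transformation C C id_functor id_functor e by fact
  have nat: "natural_transformation C C G (G \<circ>\<^sub>F G) d"
  proof unfold_locales
    fix A assume "A \<in> Obj C"
    then show "d A \<in> hom C (fo G A) (fo (G \<circ>\<^sub>F G) A)"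
      by (simp add: d hom_iff)
  next
    fix f A B assume "f \<in> hom C A B"
    then have f: "f \<in> Arr C" "Dom C f = A" "Cod C f = B" by (simp_all add: hom_iff)
    then have AB [simp]: "A \<in> Obj C" "B \<in> Obj C" by auto
    have "d B \<cdot> fa G f = fa G (e (fo G B)) \<cdot> (\<delta> B \<cdot> fa G f)"
      using f by (simp add: d)
    also have "\<dots> = fa G (e (fo G B)) \<cdot> fa G (fa G f) \<cdot> \<delta> A"
      using delta.naturality_Arr[OF f] by simp
    also have "\<dots> = fa G (e (fo G B) \<cdot> fa G f) \<cdot> \<delta> A"
      using f by simp
    also have "\<dots> = fa G (fa G f \<cdot> e (fo G A)) \<cdot> \<delta> A"
      using e.naturality_Arr[of "fa G f"] f by simp
    also have "\<dots> = fa (G \<circ>\<^sub>F G) f \<cdot> d A"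
      using f by (simp add: d)
    finally show "d B \<cdot> fa G f = fa (G \<circ>\<^sub>F G) f \<cdot> d A" .
  qed
  show ?thesis
  proof (intro q_counital_comonad.intro q_counital_comonad_axioms.intro
      category_axioms functor_G nat natural_eps)
    fix A assume A [simp]: "A \<in> Obj C"
    have "fa G (d A) \<cdot> d A = fa G (fa G (e (fo G A))) \<cdot> fa G (\<delta> A \<cdot> e (fo G A)) \<cdot> \<delta> A"
      by (simp add: d)
    also have "\<delta> A \<cdot> e (fo G A) = e (fo G (fo G A)) \<cdot> \<delta> A"
      using e.naturality_Arr[of "\<delta> A"] by simp
    also have "fa G (fa G (e (fo G A))) \<cdot> fa G (e (fo G (fo G A)) \<cdot> \<delta> A) \<cdot> \<delta> A
        = fa G (fa G (e (fo G A)) \<cdot> e (fo G (fo G A))) \<cdot> fa G (\<delta> A) \<cdot> \<delta> A"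
      by simp
    also have "fa G (e (fo G A)) \<cdot> e (fo G (fo G A)) = e (fo G (fo G A)) \<cdot> fa G (e (fo G A))"
      using e.naturality_Arr[of "fa G (e (fo G A))"] by simp
    also have "fa G (\<delta> A) \<cdot> \<delta> A = \<delta> (fo G A) \<cdot> \<delta> A"
      by (rule delta_coassoc) simp
    also have "fa G (e (fo G (fo G A)) \<cdot> fa G (e (fo G A))) \<cdot> \<delta> (fo G A) \<cdot> \<delta> A
        = fa G (e (fo G (fo G A))) \<cdot> (fa G (fa G (e (fo G A))) \<cdot> \<delta> (fo G A)) \<cdot> \<delta> A"
      by simp
    also have "fa G (fa G (e (fo G A))) \<cdot> \<delta> (fo G A) = \<delta> (fo G A) \<cdot> fa G (e (fo G A))"
      using delta.naturality_Arr[of "e (fo G A)"] by simp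
    also have "fa G (e (fo G (fo G A))) \<cdot> (\<delta> (fo G A) \<cdot> fa G (e (fo G A))) \<cdot> \<delta> A
        = d (fo G A) \<cdot> d A"
      by (simp add: d)
    finally show "fa G (d A) \<cdot> d A = d (fo G A) \<cdot> d A" .
  qed
qed

text \<open>If \<open>G\<epsilon> \<cdot> \<delta> = eG\<close>, it makes no difference on which side of \<open>\<delta>\<close> the twist is applied; this is
  coassociativity together with naturality of \<open>\<delta>\<close>.\<close>

lemma twist_eq:
  assumes counit: "\<And>A. A \<in> Obj C \<Longrightarrow> fa G (\<epsilon> A) \<cdot> \<delta> A = e (fo G A)"
    and A [simp]: "A \<in> Obj C"
  shows "fa G (e (fo G A)) \<cdot> \<delta> A = \<delta> A \<cdot> e (fo G A)"
proof -
  have "fa G (e (fo G A)) \<cdot> \<delta> A = fa G (fa G (\<epsilon> A)) \<cdot> (fa G (\<delta> A) \<cdot> \<delta> A)"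
    by (simp flip: counit)
  also have "\<dots> = fa G (fa G (\<epsilon> A)) \<cdot> \<delta> (fo G A) \<cdot> \<delta> A"
    by (simp only: delta_coassoc A)
  also have "\<dots> = (fa G (fa G (\<epsilon> A)) \<cdot> \<delta> (fo G A)) \<cdot> \<delta> A"
    by simp
  also have "\<dots> = (\<delta> A \<cdot> fa G (\<epsilon> A)) \<cdot> \<delta> A"
    using delta.naturality_Arr[of "\<epsilon> A"] by simp
  also have "\<dots> = \<delta> A \<cdot> e (fo G A)"
    by (simp flip: counit)
  finally show ?thesis .
qed

lemma r_counital_comonad_twist:
  assumes nat: "natural_transformation C C id_functor id_functor e"
    and d: "\<And>A. A \<in> Obj C \<Longrightarrow> d A = fa G (e (fo G A)) \<cdot> \<delta> A"
    and counit: "\<And>A. A \<in> Obj C \<Longrightarrow> fa G (\<epsilon> A) \<cdot> \<delta> A = e (fo G A)"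
    and absorb: "\<And>A. A \<in> Obj C \<Longrightarrow> \<epsilon> A \<cdot> e (fo G A) = \<epsilon> A"
  shows "r_counital_comonad C G d \<epsilon>"
proof -
  interpret e: natural_transformation C C id_functor id_functor e by (rule nat)
  interpret d: q_counital_comonad C G d \<epsilon>
    using nat d by (rule q_counital_comonad_twist)
  have eps_d: "fa G (\<epsilon> A) \<cdot> d A = e (fo G A)" if [simp]: "A \<in> Obj C" for A
  proof -
    have "fa G (\<epsilon> A) \<cdot> d A = fa G (\<epsilon> A \<cdot> e (fo G A)) \<cdot> \<delta> A"
      by (simp add: d del: d.delta.component_simps)
    then show ?thesis by (simp add: absorb counit)
  qed
  show ?thesis
  proof unfold_locales
    show "regular_counit C G d \<epsilon>"
      by (simp add: regular_counit_def eps_d absorb)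
  next
    fix A assume A [simp]: "A \<in> Obj C"
    \<comment> \<open>Idempotence of \<open>eG\<close> need not be assumed: \<open>eG \<cdot> eG = G\<epsilon> \<cdot> \<delta> \<cdot> eG = G\<epsilon> \<cdot> d = eG\<close>.\<close>
    have idem: "e (fo G A) \<cdot> e (fo G A) = e (fo G A)"
    proof -
      have "e (fo G A) \<cdot> e (fo G A) = fa G (\<epsilon> A) \<cdot> \<delta> A \<cdot> e (fo G A)"
        by (simp flip: counit)
      also have "\<delta> A \<cdot> e (fo G A) = d A"
        by (simp only: d twist_eq[OF counit] A)
      finally show ?thesis by (simp only: eps_d A)
    qed
    have "fa G (\<epsilon> (fo G A)) \<cdot> d (fo G A) \<cdot> d A = (fa G (\<epsilon> (fo G A)) \<cdot> d (fo G A)) \<cdot> d A"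
      by simp
    also have "\<dots> = e (fo G (fo G A)) \<cdot> d A"
      by (simp only: eps_d G.fo_in_Obj A)
    also have "\<dots> = d A \<cdot> e (fo G A)"
      using e.naturality_Arr[of "d A"] by simp
    also have "\<dots> = \<delta> A \<cdot> e (fo G A) \<cdot> e (fo G A)"
      by (simp add: d twist_eq[OF counit] del: d.delta.component_simps)
    also have "\<dots> = d A"
      by (simp add: idem d twist_eq[OF counit])
    finally show "d A = fa G (\<epsilon> (fo G A)) \<cdot> d (fo G A) \<cdot> d A" ..
  qed
qed

lemma weak_comonad_twist:
  assumes nat: "natural_transformation C C id_functor id_functor e"
    and d: "\<And>A. A \<in> Obj C \<Longrightarrow> d A = fa G (e (fo G A)) \<cdot> \<delta> A"
    and counit: "\<And>A. A \<in> Obj C \<Longrightarrow> fa G (\<epsilon> A) \<cdot> \<delta> A = e (fo G A)"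
    and counit': "\<And>A. A \<in> Obj C \<Longrightarrow> \<epsilon> (fo G A) \<cdot> \<delta> A = e (fo G A)"
    and absorb: "\<And>A. A \<in> Obj C \<Longrightarrow> \<epsilon> A \<cdot> e (fo G A) = \<epsilon> A"
  shows "weak_comonad C G d \<epsilon>"
proof -
  interpret e: natural_transformation C C id_functor id_functor e by (rule nat)
  interpret d: r_counital_comonad C G d \<epsilon>
    using nat d counit absorb by (rule r_counital_comonad_twist)
  show ?thesis
  proof unfold_locales
    fix A assume A [simp]: "A \<in> Obj C"
    have "fa G (\<epsilon> A) \<cdot> d A = fa G (\<epsilon> A \<cdot> e (fo G A)) \<cdot> \<delta> A"
      by (simp add: d del: d.delta.component_simps)
    also have "\<dots> = \<epsilon> (fo G A) \<cdot> \<delta> A"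
      by (simp add: absorb counit counit')
    also have "\<dots> = (\<epsilon> (fo G A) \<cdot> e (fo G (fo G A))) \<cdot> \<delta> A"
      by (simp only: absorb G.fo_in_Obj A)
    also have "\<dots> = \<epsilon> (fo G A) \<cdot> (e (fo G (fo G A)) \<cdot> \<delta> A)"
      by simp
    also have "e (fo G (fo G A)) \<cdot> \<delta> A = d A"
      using e.naturality_Arr[of "\<delta> A"] by (simp add: d twist_eq[OF counit])
    finally show "fa G (\<epsilon> A) \<cdot> d A = \<epsilon> (fo G A) \<cdot> d A" .
  qed
qed

end


section \<open>The category of compatible modules\<close>

context q_unital_monad
begin

abbreviation Mod :: "(('o, 'm) fmod, ('o, 'm) fmod_arr) category" where
  "Mod \<equiv> module_category C F \<mu> \<eta>"

lemma Obj_Mod_iff: "(A, \<phi>) \<in> Obj Mod \<longleftrightarrow>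
    A \<in> Obj C \<and> \<phi> \<in> Arr C \<and> Dom C \<phi> = fo F A \<and> Cod C \<phi> = A \<and>
    \<phi> \<cdot> fa F \<phi> = \<phi> \<cdot> \<mu> A \<and> \<phi> = \<phi> \<cdot> \<mu> A \<cdot> fa F (\<eta> A)"
  by (simp add: module_category_def compatible_module_def hom_iff)

lemma Arr_Mod_iff: "(M, f, N) \<in> Arr Mod \<longleftrightarrow>
    M \<in> Obj Mod \<and> N \<in> Obj Mod \<and> f \<in> Arr C \<and> Dom C f = fst M \<and> Cod C f = fst N \<and>
    snd N \<cdot> fa F f = f \<cdot> snd M"
  by (auto simp: module_category_def hom_iff)

lemma Mod_simps [simp]:
  "Dom Mod (M, f, N) = M" "Cod Mod (M, f, N) = N"
  "Ide Mod M = (M, Ide C (fst M), M)"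
  "(N', g, K) \<cdot>\<^bsub>Mod\<^esub> (M, f, N) = (M, g \<cdot> f, K)"
  by (simp_all add: module_category_def)

lemma hom_ModE:
  assumes "t \<in> hom Mod M N"
  obtains f where "t = (M, f, N)" "(M, f, N) \<in> Arr Mod"
proof -
  obtain M' f N' where "t = (M', f, N')" by (metis prod_cases3)
  with assms show thesis
    by (auto simp: hom_iff intro: that)
qed

lemma category_Mod: "category Mod"
proof unfold_locales
  fix t assume "t \<in> Arr Mod"
  then show "Dom Mod t \<in> Obj Mod" "Cod Mod t \<in> Obj Mod"
    by (cases t; simp add: Arr_Mod_iff)+
next
  fix M assume "M \<in> Obj Mod"
  then show "Ide Mod M \<in> hom Mod M M"
    by (cases M) (simp add: hom_iff Arr_Mod_iff Obj_Mod_iff)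
next
  fix s t L M N assume "s \<in> hom Mod L M" "t \<in> hom Mod M N"
  then obtain f g where s: "s = (L, f, M)" "(L, f, M) \<in> Arr Mod"
      and t: "t = (M, g, N)" "(M, g, N) \<in> Arr Mod"
    by (cases s; cases t) (auto simp: hom_iff)
  obtain A \<phi> B \<psi> D \<chi> where LMN: "L = (A, \<phi>)" "M = (B, \<psi>)" "N = (D, \<chi>)"
    by (metis surj_pair)
  have f: "f \<in> Arr C" "Dom C f = A" "Cod C f = B" "\<psi> \<cdot> fa F f = f \<cdot> \<phi>"
    and g: "g \<in> Arr C" "Dom C g = B" "Cod C g = D" "\<chi> \<cdot> fa F g = g \<cdot> \<psi>"
    and \<phi>: "\<phi> \<in> Arr C" "Dom C \<phi> = fo F A" "Cod C \<phi> = A"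
    and \<psi>: "\<psi> \<in> Arr C" "Dom C \<psi> = fo F B" "Cod C \<psi> = B"
    and \<chi>: "\<chi> \<in> Arr C" "Dom C \<chi> = fo F D" "Cod C \<chi> = D"
    using s t LMN by (simp_all add: Arr_Mod_iff Obj_Mod_iff)
  have "\<chi> \<cdot> fa F (g \<cdot> f) = (\<chi> \<cdot> fa F g) \<cdot> fa F f" using f(1-3) g(1-3) \<chi> by simp
  also have "\<dots> = g \<cdot> (\<psi> \<cdot> fa F f)" using f(1-3) g \<psi> by simp
  also have "\<dots> = (g \<cdot> f) \<cdot> \<phi>" using f g(1-3) \<phi> by simp
  finally show "t \<cdot>\<^bsub>Mod\<^esub> s \<in> hom Mod L N"
    using s t f g LMN by (simp add: hom_iff Arr_Mod_iff)
next
  fix s L M assume "s \<in> hom Mod L M"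
  then show "s \<cdot>\<^bsub>Mod\<^esub> Ide Mod L = s" "Ide Mod M \<cdot>\<^bsub>Mod\<^esub> s = s"
    by (cases s; auto simp: hom_iff Arr_Mod_iff)+
next
  fix r s t K L M N
  assume "r \<in> hom Mod K L" "s \<in> hom Mod L M" "t \<in> hom Mod M N"
  then show "(t \<cdot>\<^bsub>Mod\<^esub> s) \<cdot>\<^bsub>Mod\<^esub> r = t \<cdot>\<^bsub>Mod\<^esub> s \<cdot>\<^bsub>Mod\<^esub> r"
    by (cases r; cases s; cases t) (auto simp: hom_iff Arr_Mod_iff)
qed

text \<open>The endomorphism \<open>\<phi> \<cdot> \<eta>\<^sub>A\<close> of a module \<open>(A, \<phi>)\<close>, as a triple with source and target; for a
  unital module it is the identity.\<close>

definition unit_action :: "('o, 'm) fmod \<Rightarrow> ('o, 'm) fmod_arr" where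
  "unit_action = (\<lambda>(A, \<phi>). ((A, \<phi>), \<phi> \<cdot> \<eta> A, (A, \<phi>)))"

lemma action_unit_right:
  assumes "(A, \<phi>) \<in> Obj Mod"
  shows "\<phi> \<cdot> fa F \<phi> \<cdot> fa F (\<eta> A) = \<phi>"
proof -
  have \<phi>: "A \<in> Obj C" "\<phi> \<in> Arr C" "Dom C \<phi> = fo F A" "Cod C \<phi> = A"
    and mult: "\<phi> \<cdot> fa F \<phi> = \<phi> \<cdot> \<mu> A" and comp: "\<phi> = \<phi> \<cdot> \<mu> A \<cdot> fa F (\<eta> A)"
    using assms by (simp_all add: Obj_Mod_iff)
  have "\<phi> \<cdot> fa F \<phi> \<cdot> fa F (\<eta> A) = (\<phi> \<cdot> fa F \<phi>) \<cdot> fa F (\<eta> A)" using \<phi> by simp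
  also have "\<dots> = \<phi> \<cdot> \<mu> A \<cdot> fa F (\<eta> A)" unfolding mult using \<phi> by simp
  finally show ?thesis using comp by simp
qed

end

context weak_monad
begin

text \<open>Here symmetry of \<open>\<eta>\<close> is needed: naturality of \<open>\<eta>\<close> produces \<open>\<mu> \<cdot> \<eta>F\<close>, while compatibility of a
  module is stated with \<open>\<mu> \<cdot> F\<eta>\<close>.\<close>

lemma action_unit_left:
  assumes "(A, \<phi>) \<in> Obj Mod"
  shows "\<phi> \<cdot> \<eta> A \<cdot> \<phi> = \<phi>"
proof -
  have \<phi>: "A \<in> Obj C" "\<phi> \<in> Arr C" "Dom C \<phi> = fo F A" "Cod C \<phi> = A"
    and mult: "\<phi> \<cdot> fa F \<phi> = \<phi> \<cdot> \<mu> A" and comp: "\<phi> = \<phi> \<cdot> \<mu> A \<cdot> fa F (\<eta> A)"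
    using assms by (simp_all add: Obj_Mod_iff)
  have "\<eta> A \<cdot> \<phi> = fa F \<phi> \<cdot> \<eta> (fo F A)"
    using eta.naturality_Arr[of \<phi>] \<phi> by simp
  then have "\<phi> \<cdot> \<eta> A \<cdot> \<phi> = (\<phi> \<cdot> fa F \<phi>) \<cdot> \<eta> (fo F A)" using \<phi> by simp
  also have "\<dots> = \<phi> \<cdot> (\<mu> A \<cdot> \<eta> (fo F A))" unfolding mult using \<phi> by simp
  also have "\<dots> = \<phi>" using comp \<phi> by (simp flip: eta_symmetric)
  finally show ?thesis .
qed

lemma natural_unit_action: "natural_transformation Mod Mod id_functor id_functor unit_action"
proof -
  interpret Mod: category Mod by (rule category_Mod)
  interpret I: is_functor Mod Mod id_functor by (rule Mod.is_functor_id)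
  show ?thesis
  proof unfold_locales
    fix M assume M: "M \<in> Obj Mod"
    obtain A \<phi> where [simp]: "M = (A, \<phi>)" by (cases M)
    have "A \<in> Obj C" "\<phi> \<in> Arr C" "Dom C \<phi> = fo F A" "Cod C \<phi> = A"
      using M by (simp_all add: Obj_Mod_iff)
    with action_unit_left action_unit_right M
    show "unit_action M \<in> hom Mod (fo id_functor M) (fo id_functor M)"
      by (simp add: unit_action_def hom_iff Arr_Mod_iff)
  next
    fix t M N assume "t \<in> hom Mod M N"
    then obtain f where t: "t = (M, f, N)" and arr: "(M, f, N) \<in> Arr Mod"
      by (rule hom_ModE)
    obtain A \<phi> B \<psi> where MN: "M = (A, \<phi>)" "N = (B, \<psi>)" by (cases M; cases N)
    have f: "f \<in> Arr C" "Dom C f = A" "Cod C f = B" and comm: "\<psi> \<cdot> fa F f = f \<cdot> \<phi>"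
      and \<phi>: "A \<in> Obj C" "\<phi> \<in> Arr C" "Dom C \<phi> = fo F A" "Cod C \<phi> = A"
      and \<psi>: "B \<in> Obj C" "\<psi> \<in> Arr C" "Dom C \<psi> = fo F B" "Cod C \<psi> = B"
      using arr MN by (simp_all add: Arr_Mod_iff Obj_Mod_iff)
    have "\<eta> B \<cdot> f = fa F f \<cdot> \<eta> A"
      using eta.naturality_Arr[OF f] by simp
    then have "(\<psi> \<cdot> \<eta> B) \<cdot> f = (\<psi> \<cdot> fa F f) \<cdot> \<eta> A" using f \<psi> \<phi>(1) by simp
    also have "\<dots> = f \<cdot> \<phi> \<cdot> \<eta> A" unfolding comm using f \<phi> by simp
    finally show "unit_action N \<cdot>\<^bsub>Mod\<^esub> fa id_functor t = fa id_functor t \<cdot>\<^bsub>Mod\<^esub> unit_action M"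
      using t MN by (simp add: unit_action_def)
  qed
qed

end


section \<open>Lifting the comonad to compatible modules\<close>

text \<open>A natural transformation \<open>\<omega> : FG \<rightarrow> GF\<close> respecting \<open>\<mu>\<close>, \<open>\<theta> = \<mu> \<cdot> F\<eta>\<close> and \<open>\<delta>\<close>, subject to the
  mixed condition that makes \<open>\<epsilon>bar\<close> a module morphism.\<close>

locale comonad_lifting =
  weak_monad C F \<mu> \<eta> + weak_comonad C G \<delta> \<epsilon> +
  omega: natural_transformation C C "F \<circ>\<^sub>F G" "G \<circ>\<^sub>F F" \<omega>
  for C :: "('o, 'm) category" (structure)
    and F :: "('o, 'm) endo" and \<mu> \<eta> :: "'o \<Rightarrow> 'm"
    and G :: "('o, 'm) endo" and \<delta> \<epsilon> :: "'o \<Rightarrow> 'm"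
    and \<omega> :: "'o \<Rightarrow> 'm" +
  assumes omega_mu: "A \<in> Obj C \<Longrightarrow>
      \<omega> A \<cdot> \<mu> (fo G A) = fa G (\<mu> A) \<cdot> \<omega> (fo F A) \<cdot> fa F (\<omega> A)"
    and omega_theta: "A \<in> Obj C \<Longrightarrow> \<omega> A \<cdot> theta C F \<mu> \<eta> (fo G A) = \<omega> A"
    and delta_omega: "A \<in> Obj C \<Longrightarrow>
      \<delta> (fo F A) \<cdot> \<omega> A = fa G (\<omega> A) \<cdot> \<omega> (fo G A) \<cdot> fa F (\<delta> A)"
    and eps_omega: "A \<in> Obj C \<Longrightarrow> \<epsilon> (fo F A) \<cdot> \<omega> A =
      \<mu> A \<cdot> fa F (\<epsilon> (fo F A)) \<cdot> fa F (\<omega> A) \<cdot> fa F (\<eta> (fo G A))"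
begin

abbreviation "Gbar \<equiv> lift_functor C G \<omega>"
abbreviation "\<epsilon>bar \<equiv> eps_bar C F \<eta> G \<epsilon> \<omega>"
abbreviation "\<delta>mod \<equiv> delta_mod C G \<delta> \<omega>"
abbreviation "\<delta>bar \<equiv> delta_bar C \<eta> G \<delta> \<omega>"

lemma lift_simps [simp]:
  "fo Gbar (A, \<phi>) = (fo G A, fa G \<phi> \<cdot> \<omega> A)"
  "fa Gbar (M, f, N) = (fo Gbar M, fa G f, fo Gbar N)"
  by (simp_all add: lift_functor_def lift_obj_def)

lemma delta_mod_simp [simp]:
  "\<delta>mod (A, \<phi>) = (fo Gbar (A, \<phi>), \<delta> A, fo Gbar (fo Gbar (A, \<phi>)))"
  by (simp add: delta_mod_def lift_functor_def)

lemma eps_bar_simp [simp]: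
  "\<epsilon>bar (A, \<phi>) = (fo Gbar (A, \<phi>), \<phi> \<cdot> \<epsilon> (fo F A) \<cdot> \<omega> A \<cdot> \<eta> (fo G A), (A, \<phi>))"
  by (simp add: eps_bar_def lift_functor_def xi_def)

lemma Obj_ModD:
  assumes "(A, \<phi>) \<in> Obj Mod"
  shows "A \<in> Obj C" "\<phi> \<in> Arr C" "Dom C \<phi> = fo F A" "Cod C \<phi> = A"
  using assms by (simp_all add: Obj_Mod_iff)

text \<open>Associativity of the lifted action comes from \<open>omega_mu\<close>, its compatibility from
  \<open>omega_theta\<close>.\<close>

lemma lift_in_Obj:
  assumes M: "(A, \<phi>) \<in> Obj Mod"
  shows "(fo G A, fa G \<phi> \<cdot> \<omega> A) \<in> Obj Mod"
proof -
  note [simp] = Obj_ModD[OF M]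
  have mult: "\<phi> \<cdot> fa F \<phi> = \<phi> \<cdot> \<mu> A"
    using M by (simp add: Obj_Mod_iff)
  have "(fa G \<phi> \<cdot> \<omega> A) \<cdot> fa F (fa G \<phi> \<cdot> \<omega> A)
      = fa G \<phi> \<cdot> (\<omega> A \<cdot> fa F (fa G \<phi>)) \<cdot> fa F (\<omega> A)"
    by simp
  also have "\<omega> A \<cdot> fa F (fa G \<phi>) = fa G (fa F \<phi>) \<cdot> \<omega> (fo F A)"
    using omega.naturality_Arr[of \<phi>] by simp
  also have "fa G \<phi> \<cdot> (fa G (fa F \<phi>) \<cdot> \<omega> (fo F A)) \<cdot> fa F (\<omega> A)
      = fa G (\<phi> \<cdot> fa F \<phi>) \<cdot> \<omega> (fo F A) \<cdot> fa F (\<omega> A)"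
    by simp
  also have "\<dots> = fa G \<phi> \<cdot> (fa G (\<mu> A) \<cdot> \<omega> (fo F A) \<cdot> fa F (\<omega> A))"
    unfolding mult by simp
  also have "\<dots> = fa G \<phi> \<cdot> (\<omega> A \<cdot> \<mu> (fo G A))"
    by (simp only: omega_mu Obj_ModD[OF M])
  finally have "(fa G \<phi> \<cdot> \<omega> A) \<cdot> fa F (fa G \<phi> \<cdot> \<omega> A) = (fa G \<phi> \<cdot> \<omega> A) \<cdot> \<mu> (fo G A)"
    by simp
  moreover have "(fa G \<phi> \<cdot> \<omega> A) \<cdot> \<mu> (fo G A) \<cdot> fa F (\<eta> (fo G A)) = fa G \<phi> \<cdot> \<omega> A"
    using omega_theta[of A] by (simp add: theta_def)
  ultimately show ?thesis
    unfolding Obj_Mod_iff by simp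
qed

lemma lift_in_Arr:
  assumes arr: "(M, f, N) \<in> Arr Mod"
  shows "(fo Gbar M, fa G f, fo Gbar N) \<in> Arr Mod"
proof -
  obtain A \<phi> B \<psi> where MN: "M = (A, \<phi>)" "N = (B, \<psi>)" by (cases M; cases N)
  have M: "(A, \<phi>) \<in> Obj Mod" and N: "(B, \<psi>) \<in> Obj Mod"
    and f: "f \<in> Arr C" "Dom C f = A" "Cod C f = B" and comm: "\<psi> \<cdot> fa F f = f \<cdot> \<phi>"
    using arr MN by (simp_all add: Arr_Mod_iff)
  note [simp] = Obj_ModD[OF M] Obj_ModD[OF N]
  have "(fa G \<psi> \<cdot> \<omega> B) \<cdot> fa F (fa G f) = fa G \<psi> \<cdot> (\<omega> B \<cdot> fa F (fa G f))"
    using f by simp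
  also have "\<omega> B \<cdot> fa F (fa G f) = fa G (fa F f) \<cdot> \<omega> A"
    using omega.naturality_Arr[OF f] by simp
  also have "fa G \<psi> \<cdot> fa G (fa F f) \<cdot> \<omega> A = fa G (\<psi> \<cdot> fa F f) \<cdot> \<omega> A"
    using f by simp
  also have "\<dots> = fa G f \<cdot> fa G \<phi> \<cdot> \<omega> A"
    unfolding comm using f by simp
  finally show ?thesis
    using f MN by (simp add: Arr_Mod_iff lift_in_Obj[OF M] lift_in_Obj[OF N])
qed

lemma is_functor_lift: "is_functor Mod Mod Gbar"
proof -
  interpret Mod: category Mod by (rule category_Mod)
  show ?thesis
  proof unfold_locales
    fix M assume M: "M \<in> Obj Mod"
    then show "fo Gbar M \<in> Obj Mod"
      by (cases M) (simp add: lift_in_Obj)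
    show "fa Gbar (Ide Mod M) = Ide Mod (fo Gbar M)"
      using M by (cases M) (simp add: Obj_Mod_iff)
  next
    fix t M N assume "t \<in> hom Mod M N"
    then show "fa Gbar t \<in> hom Mod (fo Gbar M) (fo Gbar N)"
      by (rule hom_ModE) (use lift_in_Arr in \<open>simp add: hom_iff\<close>)
  next
    fix s t L M N assume "s \<in> hom Mod L M" "t \<in> hom Mod M N"
    then show "fa Gbar (t \<cdot>\<^bsub>Mod\<^esub> s) = fa Gbar t \<cdot>\<^bsub>Mod\<^esub> fa Gbar s"
      by (cases s; cases t) (auto simp: hom_iff Arr_Mod_iff)
  qed
qed

lemma natural_delta_mod: "natural_transformation Mod Mod Gbar (Gbar \<circ>\<^sub>F Gbar) \<delta>mod"
proof -
  interpret Mod: category Mod by (rule category_Mod)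
  interpret Gbar: is_functor Mod Mod Gbar by (rule is_functor_lift)
  interpret GG: is_functor Mod Mod "Gbar \<circ>\<^sub>F Gbar"
    by (rule is_functor_comp; rule is_functor_lift)
  show ?thesis
  proof unfold_locales
    fix M assume M: "M \<in> Obj Mod"
    obtain A \<phi> where A\<phi>: "M = (A, \<phi>)" by (cases M)
    have M: "(A, \<phi>) \<in> Obj Mod" using M A\<phi> by simp
    note [simp] = Obj_ModD[OF M] lift_in_Obj[OF M] lift_in_Obj[OF lift_in_Obj[OF M]]
    have "\<delta> A \<cdot> fa G \<phi> \<cdot> \<omega> A = (\<delta> A \<cdot> fa G \<phi>) \<cdot> \<omega> A"
      by simp
    also have "\<dots> = (fa G (fa G \<phi>) \<cdot> \<delta> (fo F A)) \<cdot> \<omega> A"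
      using delta.naturality_Arr[of \<phi>] by simp
    also have "\<dots> = fa G (fa G \<phi>) \<cdot> (\<delta> (fo F A) \<cdot> \<omega> A)"
      by simp
    also have "\<dots> = fa G (fa G \<phi> \<cdot> \<omega> A) \<cdot> \<omega> (fo G A) \<cdot> fa F (\<delta> A)"
      by (simp add: delta_omega)
    finally show "\<delta>mod M \<in> hom Mod (fo Gbar M) (fo (Gbar \<circ>\<^sub>F Gbar) M)"
      using A\<phi> lift_in_Obj[OF lift_in_Obj[OF M]] by (simp add: hom_iff Arr_Mod_iff)
  next
    fix t M N assume "t \<in> hom Mod M N"
    then obtain f where t: "t = (M, f, N)" and arr: "(M, f, N) \<in> Arr Mod"
      by (rule hom_ModE)
    obtain A \<phi> B \<psi> where MN: "M = (A, \<phi>)" "N = (B, \<psi>)" by (cases M; cases N)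
    have "f \<in> Arr C" "Dom C f = A" "Cod C f = B"
      using arr MN by (simp_all add: Arr_Mod_iff)
    then show "\<delta>mod N \<cdot>\<^bsub>Mod\<^esub> fa Gbar t = fa (Gbar \<circ>\<^sub>F Gbar) t \<cdot>\<^bsub>Mod\<^esub> \<delta>mod M"
      using t MN delta.naturality_Arr[of f A B] by simp
  qed
qed

lemma unit_action_lift:
  assumes "(A, \<phi>) \<in> Obj Mod"
  shows "unit_action (fo Gbar (A, \<phi>)) =
    (fo Gbar (A, \<phi>), fa G \<phi> \<cdot> \<omega> A \<cdot> \<eta> (fo G A), fo Gbar (A, \<phi>))"
  using Obj_ModD[OF assms] by (simp add: unit_action_def)

text \<open>By naturality of \<open>\<epsilon>\<close>, \<open>\<epsilon>bar\<close> is \<open>\<epsilon>\<close> precomposed with the unit action of the lifted module.\<close>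

lemma eps_bar_eq:
  assumes "(A, \<phi>) \<in> Obj Mod"
  shows "\<phi> \<cdot> \<epsilon> (fo F A) \<cdot> \<omega> A \<cdot> \<eta> (fo G A) = \<epsilon> A \<cdot> fa G \<phi> \<cdot> \<omega> A \<cdot> \<eta> (fo G A)"
proof -
  note [simp] = Obj_ModD[OF assms]
  have "\<phi> \<cdot> \<epsilon> (fo F A) \<cdot> \<omega> A \<cdot> \<eta> (fo G A) = (\<phi> \<cdot> \<epsilon> (fo F A)) \<cdot> \<omega> A \<cdot> \<eta> (fo G A)"
    by simp
  also have "\<phi> \<cdot> \<epsilon> (fo F A) = \<epsilon> A \<cdot> fa G \<phi>"
    using eps.naturality_Arr[of \<phi>] by simp
  finally show ?thesis by simp
qed

lemma eps_bar_in_Arr: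
  assumes M: "(A, \<phi>) \<in> Obj Mod"
  shows "\<epsilon>bar (A, \<phi>) \<in> Arr Mod"
proof -
  note [simp] = Obj_ModD[OF M] lift_in_Obj[OF M]
  have mult: "\<phi> \<cdot> fa F \<phi> = \<phi> \<cdot> \<mu> A"
    using M by (simp add: Obj_Mod_iff)
  \<comment> \<open>Both sides of the morphism equation reduce to \<open>\<phi> \<cdot> \<epsilon>F \<cdot> \<omega>\<close>.\<close>
  have "\<phi> \<cdot> fa F (\<phi> \<cdot> \<epsilon> (fo F A) \<cdot> \<omega> A \<cdot> \<eta> (fo G A))
      = (\<phi> \<cdot> fa F \<phi>) \<cdot> fa F (\<epsilon> (fo F A)) \<cdot> fa F (\<omega> A) \<cdot> fa F (\<eta> (fo G A))"
    by simp
  also have "\<dots> = \<phi> \<cdot> (\<mu> A \<cdot> fa F (\<epsilon> (fo F A)) \<cdot> fa F (\<omega> A) \<cdot> fa F (\<eta> (fo G A)))"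
    unfolding mult by simp
  also have "\<dots> = \<phi> \<cdot> \<epsilon> (fo F A) \<cdot> \<omega> A"
    by (simp only: eps_omega Obj_ModD[OF M])
  finally have action: "\<phi> \<cdot> fa F (\<phi> \<cdot> \<epsilon> (fo F A) \<cdot> \<omega> A \<cdot> \<eta> (fo G A)) = \<phi> \<cdot> \<epsilon> (fo F A) \<cdot> \<omega> A" .
  have "(\<phi> \<cdot> \<epsilon> (fo F A) \<cdot> \<omega> A \<cdot> \<eta> (fo G A)) \<cdot> fa G \<phi> \<cdot> \<omega> A
      = \<epsilon> A \<cdot> (fa G \<phi> \<cdot> \<omega> A) \<cdot> \<eta> (fo G A) \<cdot> (fa G \<phi> \<cdot> \<omega> A)"
    unfolding eps_bar_eq[OF M] by simp
  also have "\<dots> = (\<epsilon> A \<cdot> fa G \<phi>) \<cdot> \<omega> A"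
    unfolding action_unit_left[OF lift_in_Obj[OF M]] by simp
  also have "\<epsilon> A \<cdot> fa G \<phi> = \<phi> \<cdot> \<epsilon> (fo F A)"
    using eps.naturality_Arr[of \<phi>] by simp
  finally have "(\<phi> \<cdot> \<epsilon> (fo F A) \<cdot> \<omega> A \<cdot> \<eta> (fo G A)) \<cdot> fa G \<phi> \<cdot> \<omega> A = \<phi> \<cdot> \<epsilon> (fo F A) \<cdot> \<omega> A"
    by simp
  with action show ?thesis
    using M by (simp add: Arr_Mod_iff)
qed

lemma natural_eps_bar: "natural_transformation Mod Mod Gbar id_functor \<epsilon>bar"
proof -
  interpret Mod: category Mod by (rule category_Mod)
  interpret Gbar: is_functor Mod Mod Gbar by (rule is_functor_lift)
  interpret I: is_functor Mod Mod id_functor by (rule Mod.is_functor_id)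
  interpret e: natural_transformation Mod Mod id_functor id_functor unit_action
    by (rule natural_unit_action)
  show ?thesis
  proof unfold_locales
    fix M assume "M \<in> Obj Mod"
    then show "\<epsilon>bar M \<in> hom Mod (fo Gbar M) (fo id_functor M)"
      using eps_bar_in_Arr by (cases M) (simp add: hom_iff)
  next
    fix t M N assume "t \<in> hom Mod M N"
    then obtain f where t: "t = (M, f, N)" and arr: "(M, f, N) \<in> Arr Mod"
      by (rule hom_ModE)
    obtain A \<phi> B \<psi> where MN: "M = (A, \<phi>)" "N = (B, \<psi>)" by (cases M; cases N)
    have M: "(A, \<phi>) \<in> Obj Mod" and N: "(B, \<psi>) \<in> Obj Mod"
      and f: "f \<in> Arr C" "Dom C f = A" "Cod C f = B"
      using arr MN by (simp_all add: Arr_Mod_iff)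
    note [simp] = Obj_ModD[OF M] Obj_ModD[OF N]
    \<comment> \<open>\<open>?k\<close> and \<open>?l\<close> underlie the unit actions of the lifted modules; they commute with \<open>G f\<close>.\<close>
    let ?k = "fa G \<phi> \<cdot> \<omega> A \<cdot> \<eta> (fo G A)" and ?l = "fa G \<psi> \<cdot> \<omega> B \<cdot> \<eta> (fo G B)"
    have k: "?l \<cdot> fa G f = fa G f \<cdot> ?k"
      using e.naturality_Arr[OF lift_in_Arr[OF arr], of "fo Gbar M" "fo Gbar N"] MN
      by (simp add: unit_action_def)
    have "(\<psi> \<cdot> \<epsilon> (fo F B) \<cdot> \<omega> B \<cdot> \<eta> (fo G B)) \<cdot> fa G f = \<epsilon> B \<cdot> (?l \<cdot> fa G f)"
      unfolding eps_bar_eq[OF N] using f by simp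
    also have "\<dots> = (\<epsilon> B \<cdot> fa G f) \<cdot> ?k"
      unfolding k using f by simp
    also have "\<dots> = (f \<cdot> \<epsilon> A) \<cdot> ?k"
      using eps.naturality_Arr[OF f] by simp
    also have "\<dots> = f \<cdot> \<phi> \<cdot> \<epsilon> (fo F A) \<cdot> \<omega> A \<cdot> \<eta> (fo G A)"
      unfolding eps_bar_eq[OF M] using f by simp
    finally show "\<epsilon>bar N \<cdot>\<^bsub>Mod\<^esub> fa Gbar t = fa id_functor t \<cdot>\<^bsub>Mod\<^esub> \<epsilon>bar M"
      using t MN by simp
  qed
qed

lemma q_counital_comonad_Mod: "q_counital_comonad Mod Gbar \<delta>mod \<epsilon>bar"
proof (intro q_counital_comonad.intro q_counital_comonad_axioms.intro
    category_Mod is_functor_lift natural_delta_mod natural_eps_bar)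
  fix M assume "M \<in> Obj Mod"
  then show "fa Gbar (\<delta>mod M) \<cdot>\<^bsub>Mod\<^esub> \<delta>mod M = \<delta>mod (fo Gbar M) \<cdot>\<^bsub>Mod\<^esub> \<delta>mod M"
    by (cases M) (simp add: Obj_Mod_iff delta_coassoc)
qed

lemma delta_bar_eq:
  assumes "M \<in> Obj Mod"
  shows "\<delta>bar M = fa Gbar (unit_action (fo Gbar M)) \<cdot>\<^bsub>Mod\<^esub> \<delta>mod M"
proof (cases M)
  case (Pair A \<phi>)
  then show ?thesis
    using assms Obj_ModD[of A \<phi>]
    by (simp add: delta_bar_def unit_action_lift del: lift_simps(1))
       (simp add: lift_functor_def)
qed

lemma eps_bar_absorb:
  assumes "M \<in> Obj Mod"
  shows "\<epsilon>bar M \<cdot>\<^bsub>Mod\<^esub> unit_action (fo Gbar M) = \<epsilon>bar M"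
proof (cases M)
  case (Pair A \<phi>)
  then have M: "(A, \<phi>) \<in> Obj Mod" using assms by simp
  note [simp] = Obj_ModD[OF M]
  have "(\<phi> \<cdot> \<epsilon> (fo F A) \<cdot> \<omega> A \<cdot> \<eta> (fo G A)) \<cdot> fa G \<phi> \<cdot> \<omega> A \<cdot> \<eta> (fo G A)
      = \<epsilon> A \<cdot> ((fa G \<phi> \<cdot> \<omega> A) \<cdot> \<eta> (fo G A) \<cdot> (fa G \<phi> \<cdot> \<omega> A)) \<cdot> \<eta> (fo G A)"
    unfolding eps_bar_eq[OF M] by simp
  also have "\<dots> = \<phi> \<cdot> \<epsilon> (fo F A) \<cdot> \<omega> A \<cdot> \<eta> (fo G A)"
    unfolding action_unit_left[OF lift_in_Obj[OF M]] eps_bar_eq[OF M] by simp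
  finally show ?thesis
    using Pair by (simp add: unit_action_def)
qed

lemma eps_bar_counit:
  assumes eta: "\<And>A. A \<in> Obj C \<Longrightarrow> \<omega> A \<cdot> \<eta> (fo G A) =
      fa G (\<epsilon> (fo F A)) \<cdot> fa G (\<omega> A) \<cdot> fa G (\<eta> (fo G A)) \<cdot> \<delta> A"
    and "M \<in> Obj Mod"
  shows "fa Gbar (\<epsilon>bar M) \<cdot>\<^bsub>Mod\<^esub> \<delta>mod M = unit_action (fo Gbar M)"
proof (cases M)
  case (Pair A \<phi>)
  then have M: "(A, \<phi>) \<in> Obj Mod" using assms by simp
  note [simp] = Obj_ModD[OF M]
  have "fa G (\<phi> \<cdot> \<epsilon> (fo F A) \<cdot> \<omega> A \<cdot> \<eta> (fo G A)) \<cdot> \<delta> A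
      = fa G \<phi> \<cdot> fa G (\<epsilon> (fo F A)) \<cdot> fa G (\<omega> A) \<cdot> fa G (\<eta> (fo G A)) \<cdot> \<delta> A"
    by simp
  also have "\<dots> = (fa G \<phi> \<cdot> \<omega> A) \<cdot> \<eta> (fo G A)"
    unfolding eta[OF Obj_ModD(1)[OF M], symmetric] by simp
  finally show ?thesis
    using Pair by (simp add: unit_action_def)
qed

lemma r_counital_comonad_Mod:
  assumes "\<And>A. A \<in> Obj C \<Longrightarrow> \<omega> A \<cdot> \<eta> (fo G A) =
      fa G (\<epsilon> (fo F A)) \<cdot> fa G (\<omega> A) \<cdot> fa G (\<eta> (fo G A)) \<cdot> \<delta> A"
  shows "r_counital_comonad Mod Gbar \<delta>bar \<epsilon>bar"
  using q_counital_comonad_Mod natural_unit_action delta_bar_eq eps_bar_counit[OF assms]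
    eps_bar_absorb
  by (rule q_counital_comonad.r_counital_comonad_twist)

lemma regular_counit_Mod:
  assumes "\<And>A. A \<in> Obj C \<Longrightarrow> \<omega> A \<cdot> \<eta> (fo G A) =
      fa G (\<epsilon> (fo F A)) \<cdot> fa G (\<omega> A) \<cdot> fa G (\<eta> (fo G A)) \<cdot> \<delta> A"
  shows "regular_counit Mod Gbar \<delta>mod \<epsilon>bar"
  by (simp add: regular_counit_def eps_bar_counit[OF assms] eps_bar_absorb)

lemma underlying_delta_bar_free:
  "underlying (\<delta>bar (free_module F \<mu> A)) =
    fa G (kappa_hat C F \<mu> \<eta> G \<omega> A) \<cdot> \<delta> (fo F A)"
  by (simp add: underlying_def delta_bar_def free_module_def kappa_hat_def)


section \<open>The case \<open>\<omega> \<cdot> \<eta>G = G\<eta> \<cdot> \<gamma>\<close>\<close>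

lemma gamma_Arr:
  assumes [simp]: "A \<in> Obj C"
  shows "gamma C G \<delta> \<epsilon> A \<in> Arr C" "Dom C (gamma C G \<delta> \<epsilon> A) = fo G A"
    "Cod C (gamma C G \<delta> \<epsilon> A) = fo G A"
  by (simp_all add: gamma_def)

lemma delta_gamma:
  assumes [simp]: "A \<in> Obj C"
  shows "\<delta> A \<cdot> gamma C G \<delta> \<epsilon> A = fa G (gamma C G \<delta> \<epsilon> A) \<cdot> \<delta> A"
proof -
  have "\<delta> A \<cdot> gamma C G \<delta> \<epsilon> A = (\<delta> A \<cdot> fa G (\<epsilon> A)) \<cdot> \<delta> A"
    by (simp add: gamma_def)
  also have "\<dots> = (fa G (fa G (\<epsilon> A)) \<cdot> \<delta> (fo G A)) \<cdot> \<delta> A"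
    using delta.naturality_Arr[of "\<epsilon> A"] by simp
  also have "\<dots> = fa G (gamma C G \<delta> \<epsilon> A) \<cdot> \<delta> A"
    by (simp add: gamma_def delta_coassoc)
  finally show ?thesis .
qed

lemma gamma_idem:
  assumes [simp]: "A \<in> Obj C"
  shows "gamma C G \<delta> \<epsilon> A \<cdot> gamma C G \<delta> \<epsilon> A = gamma C G \<delta> \<epsilon> A"
proof -
  note [simp] = gamma_Arr[OF assms]
  have reg: "\<epsilon> A \<cdot> gamma C G \<delta> \<epsilon> A = \<epsilon> A"
    using eps_regular by (simp add: regular_counit_def gamma_def)
  have "gamma C G \<delta> \<epsilon> A \<cdot> gamma C G \<delta> \<epsilon> A = fa G (\<epsilon> A) \<cdot> (\<delta> A \<cdot> gamma C G \<delta> \<epsilon> A)"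
    by (subst (1) gamma_def) simp
  also have "\<dots> = fa G (\<epsilon> A \<cdot> gamma C G \<delta> \<epsilon> A) \<cdot> \<delta> A"
    unfolding delta_gamma[OF assms] by simp
  finally show ?thesis by (simp add: reg) (simp add: gamma_def)
qed

lemma gamma_natural:
  assumes f: "f \<in> Arr C" "Dom C f = A" "Cod C f = B"
  shows "gamma C G \<delta> \<epsilon> B \<cdot> fa G f = fa G f \<cdot> gamma C G \<delta> \<epsilon> A"
proof -
  have [simp]: "A \<in> Obj C" "B \<in> Obj C" using f by auto
  have "gamma C G \<delta> \<epsilon> B \<cdot> fa G f = fa G (\<epsilon> B) \<cdot> (\<delta> B \<cdot> fa G f)"
    using f by (simp add: gamma_def)
  also have "\<dots> = fa G (\<epsilon> B \<cdot> fa G f) \<cdot> \<delta> A"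
    using delta.naturality_Arr[OF f] f by simp
  also have "\<dots> = fa G (f \<cdot> \<epsilon> A) \<cdot> \<delta> A"
    using eps.naturality_Arr[OF f] by simp
  also have "\<dots> = fa G f \<cdot> gamma C G \<delta> \<epsilon> A"
    using f by (simp add: gamma_def)
  finally show ?thesis .
qed

text \<open>The hypothesis of the second part of the theorem implies that of the first.\<close>

lemma omega_eta_from_gamma:
  assumes eta: "\<And>A. A \<in> Obj C \<Longrightarrow> \<omega> A \<cdot> \<eta> (fo G A) = fa G (\<eta> A) \<cdot> gamma C G \<delta> \<epsilon> A"
    and A: "A \<in> Obj C"
  shows "\<omega> A \<cdot> \<eta> (fo G A) =
    fa G (\<epsilon> (fo F A)) \<cdot> fa G (\<omega> A) \<cdot> fa G (\<eta> (fo G A)) \<cdot> \<delta> A"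
proof -
  note [simp] = A gamma_Arr[OF A]
  have "fa G (\<epsilon> (fo F A)) \<cdot> fa G (\<omega> A) \<cdot> fa G (\<eta> (fo G A)) \<cdot> \<delta> A
      = fa G (\<epsilon> (fo F A)) \<cdot> fa G (\<omega> A \<cdot> \<eta> (fo G A)) \<cdot> \<delta> A"
    by simp
  also have "\<dots> = fa G (\<epsilon> (fo F A) \<cdot> fa G (\<eta> A)) \<cdot> fa G (gamma C G \<delta> \<epsilon> A) \<cdot> \<delta> A"
    unfolding eta[OF A] by simp
  also have "\<epsilon> (fo F A) \<cdot> fa G (\<eta> A) = \<eta> A \<cdot> \<epsilon> A"
    using eps.naturality_Arr[of "\<eta> A"] by simp
  also have "fa G (\<eta> A \<cdot> \<epsilon> A) \<cdot> fa G (gamma C G \<delta> \<epsilon> A) \<cdot> \<delta> A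
      = fa G (\<eta> A) \<cdot> fa G (\<epsilon> A) \<cdot> (\<delta> A \<cdot> gamma C G \<delta> \<epsilon> A)"
    by (simp add: delta_gamma)
  also have "\<dots> = fa G (\<eta> A) \<cdot> ((fa G (\<epsilon> A) \<cdot> \<delta> A) \<cdot> gamma C G \<delta> \<epsilon> A)"
    by simp
  also have "\<dots> = fa G (\<eta> A) \<cdot> gamma C G \<delta> \<epsilon> A"
    by (simp only: gamma_def[symmetric] gamma_idem[OF A])
  finally show ?thesis by (simp only: eta[OF A])
qed

lemma eps_bar_counit_symmetric:
  assumes eta: "\<And>A. A \<in> Obj C \<Longrightarrow> \<omega> A \<cdot> \<eta> (fo G A) = fa G (\<eta> A) \<cdot> gamma C G \<delta> \<epsilon> A"
    and "M \<in> Obj Mod"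
  shows "\<epsilon>bar (fo Gbar M) \<cdot>\<^bsub>Mod\<^esub> \<delta>mod M = unit_action (fo Gbar M)"
proof (cases M)
  case (Pair A \<phi>)
  then have M: "(A, \<phi>) \<in> Obj Mod" using assms by simp
  interpret e: natural_transformation Mod Mod id_functor id_functor unit_action
    by (rule natural_unit_action)
  interpret dm: natural_transformation Mod Mod Gbar "Gbar \<circ>\<^sub>F Gbar" \<delta>mod
    by (rule natural_delta_mod)
  note [simp] = Obj_ModD[OF M] gamma_Arr[OF Obj_ModD(1)[OF M]]
  let ?\<gamma> = "gamma C G \<delta> \<epsilon> A" and ?\<psi> = "fa G \<phi> \<cdot> \<omega> A"
  have unit: "?\<psi> \<cdot> \<eta> (fo G A) = ?\<gamma> \<cdot> fa G (\<phi> \<cdot> \<eta> A)"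
  proof -
    have "?\<psi> \<cdot> \<eta> (fo G A) = fa G (\<phi> \<cdot> \<eta> A) \<cdot> ?\<gamma>"
      by (simp add: eta)
    also have "\<dots> = ?\<gamma> \<cdot> fa G (\<phi> \<cdot> \<eta> A)"
      using gamma_natural[of "\<phi> \<cdot> \<eta> A" A A] by simp
    finally show ?thesis .
  qed
  \<comment> \<open>\<open>\<delta>\<^sub>A\<close> is a module morphism, so it commutes with the unit actions.\<close>
  have comm: "(fa G ?\<psi> \<cdot> \<omega> (fo G A) \<cdot> \<eta> (fo G (fo G A))) \<cdot> \<delta> A
      = \<delta> A \<cdot> ?\<psi> \<cdot> \<eta> (fo G A)"
    using e.naturality_Arr[of "\<delta>mod M" "fo Gbar M" "fo Gbar (fo Gbar M)"]
      dm.component_simps[of M] M Pair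
    by (simp add: unit_action_def)
  have "(?\<psi> \<cdot> \<epsilon> (fo F (fo G A)) \<cdot> \<omega> (fo G A) \<cdot> \<eta> (fo G (fo G A))) \<cdot> \<delta> A
      = \<epsilon> (fo G A) \<cdot> ((fa G ?\<psi> \<cdot> \<omega> (fo G A) \<cdot> \<eta> (fo G (fo G A))) \<cdot> \<delta> A)"
    unfolding eps_bar_eq[OF lift_in_Obj[OF M]] by simp
  also have "\<dots> = (\<epsilon> (fo G A) \<cdot> \<delta> A) \<cdot> (?\<psi> \<cdot> \<eta> (fo G A))"
    unfolding comm by simp
  also have "\<epsilon> (fo G A) \<cdot> \<delta> A = ?\<gamma>"
    by (simp add: gamma_def eps_symmetric)
  also have "?\<gamma> \<cdot> (?\<psi> \<cdot> \<eta> (fo G A)) = (?\<gamma> \<cdot> ?\<gamma>) \<cdot> fa G (\<phi> \<cdot> \<eta> A)"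
    unfolding unit by simp
  also have "\<dots> = ?\<psi> \<cdot> \<eta> (fo G A)"
    by (simp only: gamma_idem Obj_ModD[OF M] unit)
  finally have "(?\<psi> \<cdot> \<epsilon> (fo F (fo G A)) \<cdot> \<omega> (fo G A) \<cdot> \<eta> (fo G (fo G A))) \<cdot> \<delta> A
      = ?\<psi> \<cdot> \<eta> (fo G A)" .
  then show ?thesis
    using Pair by (simp add: unit_action_def)
qed

lemma weak_comonad_Mod:
  assumes "\<And>A. A \<in> Obj C \<Longrightarrow> \<omega> A \<cdot> \<eta> (fo G A) = fa G (\<eta> A) \<cdot> gamma C G \<delta> \<epsilon> A"
  shows "weak_comonad Mod Gbar \<delta>bar \<epsilon>bar"
  using q_counital_comonad_Mod natural_unit_action delta_bar_eq
    eps_bar_counit[OF omega_eta_from_gamma[OF assms]] eps_bar_counit_symmetric[OF assms]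
    eps_bar_absorb
  by (rule q_counital_comonad.weak_comonad_twist)

text \<open>On free modules the unit action of the lifting is \<open>kappa_hat\<close>, so this is the identity
  \<open>G(eG) \<cdot> \<delta> = \<delta> \<cdot> eG\<close>.\<close>

lemma underlying_delta_bar_free_commute:
  assumes eta: "\<And>A. A \<in> Obj C \<Longrightarrow> \<omega> A \<cdot> \<eta> (fo G A) = fa G (\<eta> A) \<cdot> gamma C G \<delta> \<epsilon> A"
    and A [simp]: "A \<in> Obj C"
  shows "underlying (\<delta>bar (free_module F \<mu> A)) = \<delta> (fo F A) \<cdot> kappa_hat C F \<mu> \<eta> G \<omega> A"
proof -
  let ?M = "free_module F \<mu> A"
  have M: "?M \<in> Obj Mod" by (simp add: free_module_compatible)
  have "\<delta>bar ?M = fa Gbar (unit_action (fo Gbar ?M)) \<cdot>\<^bsub>Mod\<^esub> \<delta>mod ?M"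
    by (rule delta_bar_eq) (rule M)
  also have "\<dots> = \<delta>mod ?M \<cdot>\<^bsub>Mod\<^esub> unit_action (fo Gbar ?M)"
    by (rule q_counital_comonad.twist_eq[OF q_counital_comonad_Mod])
      (rule eps_bar_counit[OF omega_eta_from_gamma[OF eta]], assumption+, rule M)
  finally show ?thesis
    by (simp add: underlying_def free_module_def unit_action_def kappa_hat_def)
qed

end

theorem proposition7p9:
  fixes C :: "('o, 'm) category" (structure)
    and F G :: "('o, 'm) endo"
    and \<mu> \<eta> \<delta> \<epsilon> \<omega> :: "'o \<Rightarrow> 'm"
  assumes weak_monad: "weak_monad C F \<mu> \<eta>"
    and weak_comonad: "weak_comonad C G \<delta> \<epsilon>"
    and natural_omega: "natural_transformation C C (F \<circ>\<^sub>F G) (G \<circ>\<^sub>F F) \<omega>"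
    and omega_mu: "\<forall>A \<in> Obj C.
          \<omega> A \<cdot> \<mu> (fo G A) = fa G (\<mu> A) \<cdot> \<omega> (fo F A) \<cdot> fa F (\<omega> A)"
    and omega_theta: "\<forall>A \<in> Obj C. \<omega> A \<cdot> theta C F \<mu> \<eta> (fo G A) = \<omega> A"
    and theta_omega: "\<forall>A \<in> Obj C. fa G (theta C F \<mu> \<eta> A) \<cdot> \<omega> A = \<omega> A"
    and delta_omega: "\<forall>A \<in> Obj C.
          \<delta> (fo F A) \<cdot> \<omega> A = fa G (\<omega> A) \<cdot> \<omega> (fo G A) \<cdot> fa F (\<delta> A)"
    and omega_gamma: "\<forall>A \<in> Obj C. \<omega> A \<cdot> fa F (gamma C G \<delta> \<epsilon> A) = \<omega> A"
    and gamma_omega: "\<forall>A \<in> Obj C. gamma C G \<delta> \<epsilon> (fo F A) \<cdot> \<omega> A = \<omega> A"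
    and eps_omega: "\<forall>A \<in> Obj C.
          \<epsilon> (fo F A) \<cdot> \<omega> A =
          \<mu> A \<cdot> fa F (\<epsilon> (fo F A)) \<cdot> fa F (\<omega> A) \<cdot> fa F (\<eta> (fo G A))"
  shows "let Mod = module_category C F \<mu> \<eta>;
             Gbar = lift_functor C G \<omega>;
             \<epsilon>bar = eps_bar C F \<eta> G \<epsilon> \<omega>;
             \<delta>mod = delta_mod C G \<delta> \<omega>;
             \<delta>bar = delta_bar C \<eta> G \<delta> \<omega>;
             \<kappa> = kappa_hat C F \<mu> \<eta> G \<omega>
         in
          ((\<forall>A \<in> Obj C. \<omega> A \<cdot> \<eta> (fo G A) =
               fa G (\<epsilon> (fo F A)) \<cdot> fa G (\<omega> A) \<cdot> fa G (\<eta> (fo G A)) \<cdot> \<delta> A) \<longrightarrow>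
            natural_transformation Mod Mod Gbar (Gbar \<circ>\<^sub>F Gbar) \<delta>mod \<and>
            regular_counit Mod Gbar \<delta>mod \<epsilon>bar \<and>
            (\<forall>A \<in> Obj C. underlying (\<delta>bar (free_module F \<mu> A)) = fa G (\<kappa> A) \<cdot> \<delta> (fo F A)) \<and>
            r_counital_comonad Mod Gbar \<delta>bar \<epsilon>bar) \<and>
          ((\<forall>A \<in> Obj C. \<omega> A \<cdot> \<eta> (fo G A) = fa G (\<eta> A) \<cdot> gamma C G \<delta> \<epsilon> A) \<longrightarrow>
            (\<forall>A \<in> Obj C. underlying (\<delta>bar (free_module F \<mu> A)) = \<delta> (fo F A) \<cdot> \<kappa> A) \<and>
            weak_comonad Mod Gbar \<delta>bar \<epsilon>bar)"
proof -
  interpret comonad_lifting C F \<mu> \<eta> G \<delta> \<epsilon> \<omega>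
    using assms
    by (intro comonad_lifting.intro comonad_lifting_axioms.intro) simp_all
  show ?thesis
    unfolding Let_def
    using natural_delta_mod regular_counit_Mod underlying_delta_bar_free r_counital_comonad_Mod
      underlying_delta_bar_free_commute weak_comonad_Mod
    by simp
qed

end
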